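(* Consider, for the linear advection equation $\partial_t q+\lambda\partial_x q=0$, the MUSCL-Hancock scheme with centred slopes $$q_j^{n+1}=q_j^n-c\left[q_j^n-q_{j-1}^n+\frac{1-c}{4}\left(q_{j+1}^n-q_j^n-q_{j-1}^n+q_{j-2}^n\right)\right],$$ where $c\in\mathbb{R}$ is the Courant number. The scheme is conditionally stable in the sense of von Neumann, with stability condition $0\le c\le 1$: the amplification factor $A(\theta,c)$ satisfies $|A(\theta,c)|^2\le 1$ for all $\theta\in[-\pi,\pi]$ if and only if $0\le c\le 1$.
   Context: Here $c=\frac{\lambda\Delta t}{\Delta x}$, where $\Delta x$ and $\Delta t$ are the space and time steps of a uniform mesh. The amplification factor $A=A(\theta,c)\in\mathbb{C}$ is obtained by inserting the trial function $q_j^n=A^n e^{I\theta j}$ into the scheme, where $I$ is the imaginary unit and $\theta\in[-\pi,\pi]$; that is, $$A(\theta,c)=1-c\left[1-e^{-I\theta}+\frac{1-c}{4}\left(e^{I\theta}-1-e^{-I\theta}+e^{-2I\theta}\right)\right].$$ The scheme is called stable for a given $c$ if $|A(\theta,c)|^2\le1$ for all $\theta\in[-\pi,\pi]$. *)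

theory Defs
  imports Complex_Main
begin

definition courant_number :: "real \<Rightarrow> real \<Rightarrow> real \<Rightarrow> real" where
  "courant_number lam dt dx = lam * dt / dx"

text \<open>Grid functions are complex-valued and live on the whole integer grid, as needed for
  the trial functions of von Neumann analysis. A one-step scheme maps the grid function at
  time level \<open>n\<close> to the one at time level \<open>n + 1\<close>.\<close>

type_synonym grid_fun = "int \<Rightarrow> complex"

definition muscl_hancock_centred :: "real \<Rightarrow> grid_fun \<Rightarrow> grid_fun" where
  "muscl_hancock_centred c q j =
     q j - of_real c * (q j - q (j - 1)
       + of_real ((1 - c) / 4) * (q (j + 1) - q j - q (j - 1) + q (j - 2)))"

definition trial_function :: "complex \<Rightarrow> real \<Rightarrow> nat \<Rightarrow> grid_fun" where
  "trial_function A \<theta> n j = A ^ n * exp (\<i> * of_real \<theta> * of_int j)"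

definition solves_scheme :: "(grid_fun \<Rightarrow> grid_fun) \<Rightarrow> (nat \<Rightarrow> grid_fun) \<Rightarrow> bool" where
  "solves_scheme S q \<longleftrightarrow> (\<forall>n j. q (Suc n) j = S (q n) j)"

text \<open>The description is well defined for the scheme above: see
  \<open>solves_scheme_trial_iff\<close> and \<open>amplification_factor_muscl_hancock_centred\<close> below.\<close>

definition amplification_factor :: "(grid_fun \<Rightarrow> grid_fun) \<Rightarrow> real \<Rightarrow> complex" where
  "amplification_factor S \<theta> = (THE A. solves_scheme S (trial_function A \<theta>))"

definition von_neumann_stable :: "(grid_fun \<Rightarrow> grid_fun) \<Rightarrow> bool" where
  "von_neumann_stable S \<longleftrightarrow> (\<forall>\<theta>\<in>{-pi..pi}. (cmod (amplification_factor S \<theta>))\<^sup>2 \<le> 1)"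

definition muscl_hancock_symbol :: "real \<Rightarrow> real \<Rightarrow> complex" where
  "muscl_hancock_symbol \<theta> c =
     1 - of_real c * (1 - exp (- \<i> * of_real \<theta>)
       + of_real ((1 - c) / 4) *
         (exp (\<i> * of_real \<theta>) - 1 - exp (- \<i> * of_real \<theta>) + exp (- 2 * \<i> * of_real \<theta>)))"

lemma muscl_hancock_centred_trial:
  "muscl_hancock_centred c (trial_function A \<theta> n) j =
     muscl_hancock_symbol \<theta> c * trial_function A \<theta> n j"
proof -
  define E where "E = exp (\<i> * of_real \<theta> * of_int j :: complex)"
  have 1: "exp (\<i> * of_real \<theta> * of_int (j - 1)) = E * exp (- \<i> * of_real \<theta>)"
    unfolding E_def exp_add[symmetric] by (simp add: algebra_simps)
  have 2: "exp (\<i> * of_real \<theta> * of_int (j + 1)) = E * exp (\<i> * of_real \<theta>)"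
    unfolding E_def exp_add[symmetric] by (simp add: algebra_simps)
  have 3: "exp (\<i> * of_real \<theta> * of_int (j - 2)) = E * exp (- 2 * \<i> * of_real \<theta>)"
    unfolding E_def exp_add[symmetric] by (simp add: algebra_simps)
  show ?thesis
    unfolding muscl_hancock_centred_def trial_function_def muscl_hancock_symbol_def
      1 2 3 E_def[symmetric]
    by (simp only: algebra_simps mult_1_left mult_1_right)
qed

lemma solves_scheme_trial_iff:
  "solves_scheme (muscl_hancock_centred c) (trial_function A \<theta>) \<longleftrightarrow>
     A = muscl_hancock_symbol \<theta> c"
proof
  assume "solves_scheme (muscl_hancock_centred c) (trial_function A \<theta>)"
  then have "trial_function A \<theta> (Suc 0) 0 =
      muscl_hancock_symbol \<theta> c * trial_function A \<theta> 0 0"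
    unfolding solves_scheme_def muscl_hancock_centred_trial by blast
  then show "A = muscl_hancock_symbol \<theta> c"
    by (simp add: trial_function_def)
next
  assume "A = muscl_hancock_symbol \<theta> c"
  then show "solves_scheme (muscl_hancock_centred c) (trial_function A \<theta>)"
    unfolding solves_scheme_def muscl_hancock_centred_trial
    by (simp add: trial_function_def)
qed

lemma amplification_factor_muscl_hancock_centred:
  "amplification_factor (muscl_hancock_centred c) \<theta> = muscl_hancock_symbol \<theta> c"
  by (simp add: amplification_factor_def solves_scheme_trial_iff)

end

theory Submission
  imports Defs
begin

text \<open>
  The squared modulus of the amplification factor factorises: with
  \<open>m = c * (1 - c)\<close> and \<open>x = cos \<theta>\<close>,
  \<open>|A|^2 = 1 - m * (1 - x)^2 * (1 - m * (1 + x) / 2)\<close>.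
  If \<open>c\<close> lies in \<open>[0, 1]\<close>, then \<open>m\<close> also lies in \<open>[0, 1]\<close> and \<open>(1 + x) / 2\<close> always
  does, so every factor of the subtracted product is nonnegative and \<open>|A|^2\<close> is at most \<open>1\<close>.
  Conversely, the highest grid frequency \<open>\<theta> = \<pi>\<close> detects every instability: the last factor
  is \<open>1\<close> there and \<open>|A|^2 = 1 - 4 * m\<close>, which is at most \<open>1\<close> only if \<open>m\<close> is nonnegative,
  that is, only if \<open>c\<close> lies in \<open>[0, 1]\<close>.

  The factorisation is \<open>cmod_muscl_hancock_symbol_squared\<close>; it rests on the
  fact that the real and imaginary parts of the increment \<open>A - 1\<close> are those of the first-order
  upwind scheme, each times a correction affine in \<open>cos \<theta>\<close>.
\<close>

text \<open>The real parts of the four terms of the slope difference add up to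
  \<open>cos (2 * \<theta>) - 1 = - 2 * (1 - cos \<theta>) * (1 + cos \<theta>)\<close>, which is why the upwind
  contribution \<open>1 - cos \<theta>\<close> can be factored out.\<close>

lemma Re_muscl_hancock_symbol:
  "Re (muscl_hancock_symbol \<theta> c) =
     1 - c * (1 - cos \<theta>) * (1 - (1 - c) * (1 + cos \<theta>) / 2)"
proof -
  have "Re (muscl_hancock_symbol \<theta> c) = 1 - c * (1 - cos \<theta> + (1 - c) / 4 * (cos (2 * \<theta>) - 1))"
    by (simp add: muscl_hancock_symbol_def Re_exp)
  then show ?thesis
    unfolding cos_double_cos by (simp add: field_simps power2_eq_square)
qed

lemma Im_muscl_hancock_symbol:
  "Im (muscl_hancock_symbol \<theta> c) =
     - c * sin \<theta> * (1 + (1 - c) * (1 - cos \<theta>) / 2)"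
proof -
  have "Im (muscl_hancock_symbol \<theta> c) =
      - c * (sin \<theta> + (1 - c) / 4 * (2 * sin \<theta> - sin (2 * \<theta>)))"
    by (simp add: muscl_hancock_symbol_def Im_exp)
  then show ?thesis
    unfolding sin_double by (simp add: field_simps)
qed

text \<open>Eliminating \<open>sin \<theta>\<close> makes the squared modulus a polynomial in \<open>c\<close> and \<open>cos \<theta>\<close>.
  Its deviation from \<open>1\<close> vanishes for \<open>c = 0\<close> and \<open>c = 1\<close>, where the scheme is an exact
  shift of the grid. The double zero at \<open>cos \<theta> = 1\<close> is in keeping with second-order accuracy: the
  damping of smooth modes is of order \<open>\<theta>^4\<close>.\<close>

lemma cmod_muscl_hancock_symbol_squared:
  "(cmod (muscl_hancock_symbol \<theta> c))\<^sup>2 =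
     1 - c * (1 - c) * (1 - cos \<theta>)\<^sup>2 * (1 - c * (1 - c) * ((1 + cos \<theta>) / 2))"
proof -
  have sin_sq: "(sin \<theta>)\<^sup>2 = (1 - cos \<theta>) * (1 + cos \<theta>)"
    by (simp add: sin_squared_eq algebra_simps power2_eq_square)
  have "(cmod (muscl_hancock_symbol \<theta> c))\<^sup>2 =
      (1 - c * (1 - cos \<theta>) * (1 - (1 - c) * (1 + cos \<theta>) / 2))\<^sup>2
      + c\<^sup>2 * ((1 - cos \<theta>) * (1 + cos \<theta>)) * (1 + (1 - c) * (1 - cos \<theta>) / 2)\<^sup>2"
    unfolding cmod_power2 Re_muscl_hancock_symbol Im_muscl_hancock_symbol
    by (simp only: power_mult_distrib power2_minus sin_sq)
  also have "\<dots> = 1 - c * (1 - c) * (1 - cos \<theta>)\<^sup>2 * (1 - c * (1 - c) * ((1 + cos \<theta>) / 2))"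
    by (simp add: field_simps power2_eq_square)
  finally show ?thesis .
qed

lemma cmod_muscl_hancock_symbol_pi_squared:
  "(cmod (muscl_hancock_symbol pi c))\<^sup>2 = 1 - 4 * (c * (1 - c))"
  by (simp add: cmod_muscl_hancock_symbol_squared)

lemma cmod_muscl_hancock_symbol_squared_le_1:
  assumes "0 \<le> c" and "c \<le> 1"
  shows "(cmod (muscl_hancock_symbol \<theta> c))\<^sup>2 \<le> 1"
proof -
  have m: "0 \<le> c * (1 - c)" "c * (1 - c) \<le> 1"
    using assms by (auto intro: mult_le_one)
  have "0 \<le> 1 + cos \<theta>"
    using cos_ge_minus_one[of \<theta>] by linarith
  then have "c * (1 - c) * ((1 + cos \<theta>) / 2) \<le> 1"
    by (intro mult_le_one[OF m(2)]) simp_all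
  then have "0 \<le> c * (1 - c) * (1 - cos \<theta>)\<^sup>2 * (1 - c * (1 - c) * ((1 + cos \<theta>) / 2))"
    by (intro mult_nonneg_nonneg[OF mult_nonneg_nonneg[OF m(1)]]) auto
  then show ?thesis
    unfolding cmod_muscl_hancock_symbol_squared by linarith
qed

theorem mainTheorem2:
  fixes lam dx dt c :: real
  assumes "dx > 0" and "dt > 0"
    and "c = courant_number lam dt dx"
  shows "von_neumann_stable (muscl_hancock_centred c) \<longleftrightarrow> 0 \<le> c \<and> c \<le> 1"
proof
  assume "von_neumann_stable (muscl_hancock_centred c)"
  then have "(cmod (muscl_hancock_symbol pi c))\<^sup>2 \<le> 1"
    by (simp add: von_neumann_stable_def amplification_factor_muscl_hancock_centred)
  then have "0 \<le> c * (1 - c)"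
    unfolding cmod_muscl_hancock_symbol_pi_squared by linarith
  then show "0 \<le> c \<and> c \<le> 1"
    by (auto simp: zero_le_mult_iff)
next
  assume "0 \<le> c \<and> c \<le> 1"
  then show "von_neumann_stable (muscl_hancock_centred c)"
    by (simp add: von_neumann_stable_def amplification_factor_muscl_hancock_centred
        cmod_muscl_hancock_symbol_squared_le_1)
qed

end
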